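(* Let $n, r \in \mathbb{N}$ with $n > 2r$, and let $M$ be the Markov chain on the set of types $\{0,1,\ldots,r\}$ induced by the skewed $r$-random to top shuffle. Then $M$ is a $\overline{\varepsilon}^{(r,n-2r)}$-weighted involutory walk (with up-steps) on $\{0,1,\ldots,r\}$; that is, for all $x, y \in \{0,1,\ldots,r\}$, the probability that $M$ steps from $x$ to $r-y$ is $0$ if $y < x$, and if $y \ge x$ it is \[ \frac{\overline{\varepsilon}^{(r,n-2r)}_{[x,y]}}{\sum_{u=x}^{r} \overline{\varepsilon}^{(r,n-2r)}_{[x,u]}}, \qquad\text{where}\quad \overline{\varepsilon}^{(r,n-2r)}_{[x,y]} = \binom{r}{r-y}\binom{n-2r}{y-x}. \]
   Context: Permutations in $\mathrm{Sym}_n$ act on the right on $\{1,\ldots,n\}$, and are composed accordingly. Skewed $r$-random to top shuffle: for each $r$-subset $R$ of $\{r+1,\ldots,n\}$ let $d_R \in \mathrm{Sym}_n$ be the permutation of positions that maps $R$ to $\{1,\ldots,r\}$ preserving order, and maps $\{1,\ldots,n\}\setminus R$ to $\{r+1,\ldots,n\}$ preserving order (position $1$ is the top of the deck). Let $D$ be the set of all such $d_R$, so $|D| = \binom{n-r}{r}$. The shuffle is the random walk on $\mathrm{Sym}_n$ that moves from $g$ to $gd$ with $d$ chosen uniformly at random from $D$. Let $H = \mathrm{Sym}_r \times \mathrm{Sym}_{n-r}$ be the stabiliser in $\mathrm{Sym}_n$ of $(\{1,\ldots,r\},\{r+1,\ldots,n\})$. The double cosets in $H\backslash \mathrm{Sym}_n/H$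 are indexed by $\{0,1,\ldots,r\}$: $g$ has type $x$ (i.e. lies in the double coset indexed by $x$) if and only if $\{1,\ldots,r\}g \cap \{1,\ldots,r\}$ has size $x$. The random walk on $\mathrm{Sym}_n$ lumps on these double cosets (for every initial distribution the sequence of types is a time-homogeneous Markov chain with transition probabilities not depending on the initial distribution); $M$ is the resulting Markov chain on types. Weighted involutory walk (with up-steps) on $\{0,1,\ldots,r\}$ for a weight function $\gamma$ on intervals $[x,y]$ with $x \le y$: from $x$, choose $y \ge x$ with probability $\gamma_{[x,y]}/\sum_{u \ge x}\gamma_{[x,u]}$ and then move deterministically to $y^\star = r-y$. The weight $\overline{\varepsilon}^{(a,b)}$ is defined by $\overline{\varepsilon}^{(a,b)}_{[x,y]} = \binom{a}{r-y}\binom{b}{y-x}$. *)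

theory Defs
  imports "HOL-Combinatorics.Permutations" "HOL-Probability.Probability"
begin

definition Sym :: "nat \<Rightarrow> (nat \<Rightarrow> nat) set" where
  "Sym n = {g. g permutes {1..n}}"

text \<open>Permutations act on the right, so the product \<open>g d\<close> (first \<open>g\<close>, then \<open>d\<close>)
  is the function \<open>d \<circ> g\<close>.\<close>

definition right_mult :: "(nat \<Rightarrow> nat) \<Rightarrow> (nat \<Rightarrow> nat) \<Rightarrow> (nat \<Rightarrow> nat)" where
  "right_mult g d = d \<circ> g"

text \<open>The set of all \<open>d\<^sub>R\<close>. Given \<open>R\<close>, the conditions below determine \<open>d\<close>, and \<open>d\<close> determines
  \<open>R\<close> as the preimage of \<open>{1..r}\<close>.\<close>

definition skewed_shuffles :: "nat \<Rightarrow> nat \<Rightarrow> (nat \<Rightarrow> nat) set" where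
  "skewed_shuffles n r =
     {d \<in> Sym n. \<exists>R. R \<subseteq> {r + 1..n} \<and> card R = r \<and>
        d ` R = {1..r} \<and> strict_mono_on R d \<and>
        d ` ({1..n} - R) = {r + 1..n} \<and> strict_mono_on ({1..n} - R) d}"

definition skewed_shuffle_step :: "nat \<Rightarrow> nat \<Rightarrow> (nat \<Rightarrow> nat) \<Rightarrow> (nat \<Rightarrow> nat) pmf" where
  "skewed_shuffle_step n r g = map_pmf (right_mult g) (pmf_of_set (skewed_shuffles n r))"

definition perm_type :: "nat \<Rightarrow> (nat \<Rightarrow> nat) \<Rightarrow> nat" where
  "perm_type r g = card (g ` {1..r} \<inter> {1..r})"

text \<open>Law of the trajectory \<open>[X\<^sub>0, \<dots>, X\<^sub>t]\<close> of the walk with one-step transition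
  kernel \<open>K\<close> and initial distribution \<open>\<mu>\<close>.\<close>

primrec trajectory :: "('s \<Rightarrow> 's pmf) \<Rightarrow> 's pmf \<Rightarrow> nat \<Rightarrow> 's list pmf" where
  "trajectory K \<mu> 0 = map_pmf (\<lambda>x. [x]) \<mu>"
| "trajectory K \<mu> (Suc t) =
     bind_pmf (trajectory K \<mu> t) (\<lambda>xs. map_pmf (\<lambda>x. xs @ [x]) (K (last xs)))"

text \<open>\<open>L t\<close> is the law of \<open>[X\<^sub>0, \<dots>, X\<^sub>t]\<close> for a process \<open>X\<close>. Then \<open>X\<close> is a time-homogeneous
  Markov chain with transition probabilities \<open>P\<close> if, whenever the history \<open>[X\<^sub>0, \<dots>, X\<^sub>t] = xs\<close>
  has positive probability, the conditional probability of \<open>X\<^bsub>t+1\<^esub> = z\<close> given this history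
  is \<open>P (last xs) z\<close>.\<close>

definition markov_chain :: "(nat \<Rightarrow> 's list pmf) \<Rightarrow> ('s \<Rightarrow> 's pmf) \<Rightarrow> bool" where
  "markov_chain L P \<longleftrightarrow>
     (\<forall>t xs z. \<P>(ys in measure_pmf (L (Suc t)). butlast ys = xs) > 0 \<longrightarrow>
        \<P>(ys in measure_pmf (L (Suc t)). last ys = z \<bar> butlast ys = xs) = pmf (P (last xs)) z)"

text \<open>\<open>M\<close> is the chain on types induced by the shuffle: for every initial distribution on
  \<open>Sym n\<close> the sequence of types is a Markov chain with the same transition probabilities \<open>M\<close>.
  The states are the types \<open>0, \<dots>, r\<close>; \<open>M x\<close> is unconstrained for \<open>x > r\<close>.\<close>

definition induced_type_chain :: "nat \<Rightarrow> nat \<Rightarrow> (nat \<Rightarrow> nat pmf) \<Rightarrow> bool" where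
  "induced_type_chain n r M \<longleftrightarrow>
     (\<forall>\<mu>. set_pmf \<mu> \<subseteq> Sym n \<longrightarrow>
        markov_chain
          (\<lambda>t. map_pmf (map (perm_type r)) (trajectory (skewed_shuffle_step n r) \<mu> t)) M)"

text \<open>\<open>\<gamma> x y\<close> is the weight of the interval \<open>[x, y]\<close>, used only for \<open>x \<le> y \<le> r\<close>; \<open>q\<close> is the
  law of the intermediate choice \<open>y\<close>, before the deterministic move to \<open>r - y\<close>.\<close>

definition weighted_involutory_walk ::
    "nat \<Rightarrow> (nat \<Rightarrow> nat \<Rightarrow> real) \<Rightarrow> (nat \<Rightarrow> nat pmf) \<Rightarrow> bool" where
  "weighted_involutory_walk r \<gamma> P \<longleftrightarrow>
     (\<forall>x\<in>{0..r}. \<exists>q.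
        (\<forall>y. pmf q y = (if y \<in> {x..r} then \<gamma> x y / (\<Sum>u = x..r. \<gamma> x u) else 0)) \<and>
        P x = map_pmf (\<lambda>y. r - y) q)"

definition eps_bar :: "nat \<Rightarrow> nat \<Rightarrow> nat \<Rightarrow> nat \<Rightarrow> nat \<Rightarrow> real" where
  "eps_bar r a b x y = real (a choose (r - y)) * real (b choose (y - x))"

end

theory Submission imports Defs begin

text \<open>
  If \<open>A = {1..r}g\<close>, then \<open>g d\<^sub>R\<close> has type \<open>|A \<inter> R|\<close>. Since \<open>R\<close> is a uniformly
  chosen \<open>r\<close>-subset of \<open>{r+1..n}\<close>, and this set meets \<open>A\<close> in \<open>r - x\<close> points when \<open>g\<close> has
  type \<open>x\<close>, the next type is hypergeometric: it is \<open>r - y\<close> with probability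
  \<open>(r-x choose r-y) (n-2r+x choose y) / (n-r choose r)\<close>. This depends on \<open>g\<close> only through \<open>x\<close>, so
  the walk lumps. The numerator differs from \<open>(r choose r-y) (n-2r choose y-x)\<close> by a factor that
  does not depend on \<open>y\<close>, so normalising gives the weighted involutory walk.
\<close>

section \<open>Lumping\<close>

lemma trajectory_not_Nil: "xs \<in> set_pmf (trajectory K \<mu> t) \<Longrightarrow> xs \<noteq> []"
  by (cases t) auto

lemma trajectory_subset:
  assumes "\<And>s. s \<in> S \<Longrightarrow> set_pmf (K s) \<subseteq> S" "set_pmf \<mu> \<subseteq> S"
  shows "xs \<in> set_pmf (trajectory K \<mu> t) \<Longrightarrow> set xs \<subseteq> S"
proof (induction t arbitrary: xs)
  case 0
  then show ?case using assms(2) by auto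
next
  case (Suc t)
  then obtain ys x where ys: "ys \<in> set_pmf (trajectory K \<mu> t)" "x \<in> set_pmf (K (last ys))"
    "xs = ys @ [x]"
    by auto
  have "set ys \<subseteq> S" using Suc.IH ys(1) by blast
  moreover have "last ys \<in> set ys"
    using trajectory_not_Nil[OF ys(1)] by simp
  ultimately show ?case using assms(1)[of "last ys"] ys by auto
qed

text \<open>Dynkin's lumping criterion: each step starts at a last state in \<open>S\<close>, where
  the image law depends only on \<open>f s\<close>, so induction on time applies. Whole path laws
  are compared, not marginals, since \<open>markov_chain\<close> conditions on the full
  history.\<close>

lemma map_trajectory_lumpable:
  assumes closed: "\<And>s. s \<in> S \<Longrightarrow> set_pmf (K s) \<subseteq> S" and \<mu>: "set_pmf \<mu> \<subseteq> S"
    and lump: "\<And>s. s \<in> S \<Longrightarrow> map_pmf f (K s) = P (f s)"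
  shows "map_pmf (map f) (trajectory K \<mu> t) = trajectory P (map_pmf f \<mu>) t"
proof (induction t)
  case 0
  show ?case by (simp add: pmf.map_comp o_def)
next
  case (Suc t)
  have step: "map_pmf (\<lambda>x. map f xs @ [f x]) (K (last xs))
      = map_pmf (\<lambda>z. map f xs @ [z]) (P (last (map f xs)))"
    if xs: "xs \<in> set_pmf (trajectory K \<mu> t)" for xs
  proof -
    have ne: "xs \<noteq> []" using trajectory_not_Nil[OF xs] .
    then have "last xs \<in> S"
      using trajectory_subset[of S K, OF closed \<mu> xs] last_in_set by blast
    then have "P (last (map f xs)) = map_pmf f (K (last xs))"
      using lump ne by (simp add: last_map)
    then show ?thesis by (simp add: pmf.map_comp o_def)
  qed
  have "map_pmf (map f) (trajectory K \<mu> (Suc t)) = bind_pmf (trajectory K \<mu> t)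
      (\<lambda>xs. map_pmf (\<lambda>x. map f xs @ [f x]) (K (last xs)))"
    by (simp add: map_bind_pmf pmf.map_comp o_def)
  also have "\<dots> = bind_pmf (trajectory K \<mu> t)
      (\<lambda>xs. map_pmf (\<lambda>z. map f xs @ [z]) (P (last (map f xs))))"
    using step by (intro bind_pmf_cong) auto
  also have "\<dots> = trajectory P (map_pmf f \<mu>) (Suc t)"
    by (simp add: Suc.IH[symmetric] bind_map_pmf)
  finally show ?case .
qed

lemma map_butlast_trajectory: "map_pmf butlast (trajectory P \<nu> (Suc t)) = trajectory P \<nu> t"
  by (simp add: map_bind_pmf pmf.map_comp o_def bind_return_pmf')

text \<open>Only the history \<open>xs\<close> can be extended to \<open>xs @ [z]\<close>, so the
  mixture over histories collapses to one term.\<close>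

lemma pmf_trajectory_snoc:
  "pmf (trajectory P \<nu> (Suc t)) (xs @ [z]) = pmf (trajectory P \<nu> t) xs * pmf (P (last xs)) z"
proof -
  have eq: "pmf (map_pmf (\<lambda>x. ys @ [x]) (P (last ys))) (xs @ [z])
      = indicator {xs} ys * pmf (P (last xs)) z" for ys
  proof (cases "ys = xs")
    case True
    have "inj (\<lambda>x. xs @ [x])" by (simp add: inj_def)
    then show ?thesis using True pmf_map_inj'[of "\<lambda>x. xs @ [x]"] by simp
  next
    case False
    then have "(\<lambda>x. ys @ [x]) -` {xs @ [z]} = {}" by auto
    then show ?thesis using False by (simp add: pmf_map)
  qed
  show ?thesis
    by (simp add: pmf_bind eq measure_pmf_single)
qed

lemma trajectory_markov_chain: "markov_chain (trajectory P \<nu>) P"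
  unfolding markov_chain_def
proof (intro allI impI)
  fix t xs z
  let ?L = "trajectory P \<nu> (Suc t)"
  assume pos: "\<P>(ys in measure_pmf ?L. butlast ys = xs) > 0"
  have but: "\<P>(ys in measure_pmf ?L. butlast ys = xs) = pmf (trajectory P \<nu> t) xs"
    unfolding map_butlast_trajectory[of P \<nu> t, symmetric] by (simp add: pmf_map vimage_def)
  \<comment> \<open>The two events agree only almost surely: \<open>butlast [] = []\<close> and
    \<open>last []\<close> is unspecified, so the empty list has to be excluded through the
    support.\<close>
  have "\<P>(ys in measure_pmf ?L. last ys = z \<and> butlast ys = xs) = measure (measure_pmf ?L) {xs @ [z]}"
    using trajectory_not_Nil[of _ P \<nu> "Suc t"]
    by (intro measure_pmf.finite_measure_eq_AE)
       (auto simp: AE_measure_pmf_iff simp del: trajectory.simps)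
  also have "\<dots> = pmf (trajectory P \<nu> t) xs * pmf (P (last xs)) z"
    by (simp only: measure_pmf_single pmf_trajectory_snoc)
  finally show "\<P>(ys in measure_pmf ?L. last ys = z \<bar> butlast ys = xs) = pmf (P (last xs)) z"
    using pos unfolding cond_prob_def but by simp
qed

section \<open>The shuffles as subsets\<close>

text \<open>Since \<open>x\<close> itself is counted, ranks start at 1, as positions do; on a finite
  \<open>R\<close> this is the order isomorphism onto \<open>{1..card R}\<close>.\<close>

definition rank_in :: "nat set \<Rightarrow> nat \<Rightarrow> nat" where
  "rank_in R x = card {y \<in> R. y \<le> x}"

lemma strict_mono_on_rank_in:
  assumes "finite R"
  shows "strict_mono_on R (rank_in R)"
proof (rule strict_mono_onI)
  fix x y assume xy: "x \<in> R" "y \<in> R" "x < y"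
  then have "y \<in> {z \<in> R. z \<le> y} - {z \<in> R. z \<le> x}" by simp
  moreover have "{z \<in> R. z \<le> x} \<subseteq> {z \<in> R. z \<le> y}" using xy by auto
  ultimately have "{z \<in> R. z \<le> x} \<subset> {z \<in> R. z \<le> y}" by blast
  then show "rank_in R x < rank_in R y"
    unfolding rank_in_def using assms by (intro psubset_card_mono) simp
qed

lemma rank_in_image:
  assumes "finite R"
  shows "rank_in R ` R = {1..card R}"
proof (rule card_subset_eq)
  show "rank_in R ` R \<subseteq> {1..card R}"
  proof (intro image_subsetI)
    fix x assume "x \<in> R"
    then have "{y \<in> R. y \<le> x} \<noteq> {}" by blast
    then have "0 < rank_in R x" unfolding rank_in_def using assms by (simp add: card_gt_0_iff)
    moreover have "rank_in R x \<le> card R"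
      unfolding rank_in_def using assms by (intro card_mono) auto
    ultimately show "rank_in R x \<in> {1..card R}" by simp
  qed
  show "card (rank_in R ` R) = card {1..card R}"
    using card_image[OF strict_mono_on_imp_inj_on[OF strict_mono_on_rank_in[OF assms]]] by simp
qed simp

text \<open>Uniqueness of the order isomorphism onto an interval: \<open>d\<close> carries the part
  of \<open>R\<close> up to \<open>x\<close> onto \<open>{Suc a..d x}\<close>, and counting both
  sides gives \<open>d x\<close>. The offset \<open>a\<close> lets the lemma serve both blocks of a
  shuffle.\<close>

lemma strict_mono_on_eq_rank_in:
  assumes mono: "strict_mono_on R d" and im: "d ` R = {Suc a..b}" and x: "x \<in> R"
  shows "d x = a + rank_in R x"
proof -
  have "d ` {y \<in> R. y \<le> x} = {Suc a..d x}"
  proof (intro equalityI subsetI)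
    fix i assume "i \<in> d ` {y \<in> R. y \<le> x}"
    then obtain y where y: "y \<in> R" "y \<le> x" "i = d y" by auto
    have "d y \<le> d x"
      using strict_mono_onD[OF mono y(1) x] y(2) by (cases "y = x") auto
    moreover have "d y \<in> {Suc a..b}" using im y by blast
    ultimately show "i \<in> {Suc a..d x}" using y by auto
  next
    fix i assume i: "i \<in> {Suc a..d x}"
    moreover have "d x \<in> {Suc a..b}" using im x by blast
    ultimately have "i \<in> d ` R" using im by auto
    then obtain y where y: "y \<in> R" "i = d y" by auto
    have "y \<le> x"
    proof (rule ccontr)
      assume "\<not> y \<le> x"
      then have "d x < d y" using strict_mono_onD[OF mono x y(1)] by simp
      then show False using i y by auto
    qed
    then show "i \<in> d ` {y \<in> R. y \<le> x}" using y by auto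
  qed
  moreover have "inj_on d {y \<in> R. y \<le> x}"
    by (rule inj_on_subset[OF strict_mono_on_imp_inj_on[OF mono]]) blast
  ultimately have "rank_in R x = d x - a"
    unfolding rank_in_def using card_image[of d "{y \<in> R. y \<le> x}"] by simp
  \<comment> \<open>This makes the natural number subtraction \<open>d x - a\<close> exact.\<close>
  moreover have "d x \<in> {Suc a..b}" using im x by blast
  ultimately show ?thesis by auto
qed

text \<open>An explicit formula for \<open>d\<^sub>R\<close>, serving as the inverse of taking
  preimages of \<open>{1..r}\<close>. Points outside \<open>{1..n}\<close> are fixed, as
  \<open>permutes\<close> demands.\<close>

definition shuffle_of :: "nat \<Rightarrow> nat \<Rightarrow> nat set \<Rightarrow> nat \<Rightarrow> nat" where
  "shuffle_of n r R i =
     (if i \<in> R then rank_in R i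
      else if i \<in> {1..n} then r + rank_in ({1..n} - R) i else i)"

text \<open>The two rank functions have complementary images \<open>{1..r}\<close> and
  \<open>{r + 1..n}\<close>. Hence the glued map is onto \<open>{1..n}\<close>, so bijective by
  finiteness, and only points of \<open>R\<close> land in \<open>{1..r}\<close>.\<close>

lemma shuffle_of_in_skewed_shuffles:
  assumes R: "R \<subseteq> {r + 1..n}" "card R = r"
  shows "shuffle_of n r R \<in> skewed_shuffles n r" "shuffle_of n r R -` {1..r} = R"
proof -
  let ?d = "shuffle_of n r R" and ?C = "{1..n} - R"
  have fin: "finite R" using R(1) finite_subset by blast
  have sub: "R \<subseteq> {1..n}" using R(1) by auto
  have rn: "r \<le> n" using card_mono[OF _ sub] R(2) by simp
  have cC: "card ?C = n - r" using card_Diff_subset[OF fin sub] R(2) by simp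
  have imR: "?d ` R = {1..r}"
    using rank_in_image[OF fin] R(2) by (simp add: shuffle_of_def cong: image_cong)
  have "?d ` ?C = (+) r ` rank_in ?C ` ?C"
    by (auto simp: shuffle_of_def image_image)
  also have "\<dots> = {r + 1..n}"
    using rank_in_image[of ?C] cC rn by simp
  finally have imC: "?d ` ?C = {r + 1..n}" .
  have mR: "strict_mono_on R ?d"
    using strict_mono_on_rank_in[OF fin] by (auto simp: strict_mono_on_def shuffle_of_def)
  have mC: "strict_mono_on ?C ?d"
    using strict_mono_on_rank_in[of ?C] by (auto simp: strict_mono_on_def shuffle_of_def)
  have im: "?d ` {1..n} = {1..n}"
  proof -
    have "?d ` {1..n} = ?d ` R \<union> ?d ` ?C" using sub by blast
    also have "\<dots> = {1..n}" using imR imC rn by auto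
    finally show ?thesis .
  qed
  have perm: "?d permutes {1..n}"
  proof (rule bij_imp_permutes)
    show "bij_betw ?d {1..n} {1..n}"
      using im by (simp add: bij_betw_def finite_surj_inj)
    show "?d x = x" if "x \<notin> {1..n}" for x
      using that sub by (auto simp: shuffle_of_def)
  qed
  show "?d \<in> skewed_shuffles n r"
    unfolding skewed_shuffles_def Sym_def using perm R imR imC mR mC by blast
  have "?d -` {1..r} \<subseteq> R"
  proof
    fix i assume i: "i \<in> ?d -` {1..r}"
    then have "i \<in> {1..n}" using permutes_in_image[OF perm, of i] rn by auto
    moreover have "i \<notin> ?C"
    proof
      assume "i \<in> ?C"
      then have "?d i \<in> {r + 1..n}" using imC by blast
      then show False using i by auto
    qed
    ultimately show "i \<in> R" by blast
  qed
  then show "?d -` {1..r} = R" using imR by blast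
qed

text \<open>Injectivity of \<open>d\<close> recovers \<open>R\<close> as the preimage of
  \<open>{1..r}\<close>; on each block \<open>d\<close> is then forced to be the rank
  function.\<close>

lemma skewed_shufflesD:
  assumes "d \<in> skewed_shuffles n r" "r \<le> n"
  shows "d permutes {1..n}" "d -` {1..r} \<subseteq> {r + 1..n}" "card (d -` {1..r}) = r"
    "shuffle_of n r (d -` {1..r}) = d"
proof -
  obtain R where d: "d permutes {1..n}" and R: "R \<subseteq> {r + 1..n}" "card R = r"
    and im: "d ` R = {1..r}" "d ` ({1..n} - R) = {r + 1..n}"
    and mono: "strict_mono_on R d" "strict_mono_on ({1..n} - R) d"
    using assms by (auto simp: skewed_shuffles_def Sym_def)
  have eq: "d -` {1..r} = R"
    using permutes_inj[OF d] im(1) by (metis inj_vimage_image_eq)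
  have "shuffle_of n r R i = d i" for i
  proof (cases "i \<in> {1..n}")
    case True
    then show ?thesis
      \<comment> \<open>The offset is 0 on \<open>R\<close> and \<open>r\<close> on its
        complement.\<close>
      using strict_mono_on_eq_rank_in[OF mono(1), of 0 r i]
        strict_mono_on_eq_rank_in[OF mono(2), of r n i] im
      by (auto simp: shuffle_of_def)
  next
    case False
    then show ?thesis using R(1) permutes_not_in[OF d False] by (auto simp: shuffle_of_def)
  qed
  then show "d permutes {1..n}" "d -` {1..r} \<subseteq> {r + 1..n}" "card (d -` {1..r}) = r"
    "shuffle_of n r (d -` {1..r}) = d"
    using d R eq by auto
qed

text \<open>This turns a uniform shuffle into a uniform \<open>r\<close>-subset of
  \<open>{r + 1..n}\<close>, so that transition probabilities become counts of subsets.\<close>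

lemma bij_betw_skewed_shuffles:
  assumes "r \<le> n"
  shows "bij_betw (\<lambda>d. d -` {1..r}) (skewed_shuffles n r) {R. R \<subseteq> {r + 1..n} \<and> card R = r}"
proof (rule bij_betw_byWitness[where f' = "shuffle_of n r"])
  show "\<forall>d\<in>skewed_shuffles n r. shuffle_of n r (d -` {1..r}) = d"
    using skewed_shufflesD(4)[OF _ assms] by blast
  show "\<forall>R\<in>{R. R \<subseteq> {r + 1..n} \<and> card R = r}. shuffle_of n r R -` {1..r} = R"
    using shuffle_of_in_skewed_shuffles(2) by simp
  show "(\<lambda>d. d -` {1..r}) ` skewed_shuffles n r \<subseteq> {R. R \<subseteq> {r + 1..n} \<and> card R = r}"
    using skewed_shufflesD(2,3)[OF _ assms] by (intro image_subsetI CollectI conjI)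
  show "shuffle_of n r ` {R. R \<subseteq> {r + 1..n} \<and> card R = r} \<subseteq> skewed_shuffles n r"
    using shuffle_of_in_skewed_shuffles(1) by (intro image_subsetI) simp
qed

section \<open>The transition probabilities\<close>

text \<open>Splitting \<open>R\<close> into \<open>A \<inter> R\<close> and \<open>R - A\<close>
  gives two independent choices.\<close>

lemma card_subsets_with_intersection:
  assumes "finite B" "k \<le> r"
  shows "card {R. R \<subseteq> B \<and> card R = r \<and> card (A \<inter> R) = k}
    = (card (A \<inter> B) choose k) * (card (B - A) choose (r - k))"
proof -
  let ?S = "{R. R \<subseteq> B \<and> card R = r \<and> card (A \<inter> R) = k}"
  let ?T = "{X. X \<subseteq> A \<inter> B \<and> card X = k} \<times> {Y. Y \<subseteq> B - A \<and> card Y = r - k}"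
  have "bij_betw (\<lambda>R. (A \<inter> R, R - A)) ?S ?T"
  proof (rule bij_betw_byWitness[where f' = "\<lambda>(X, Y). X \<union> Y"])
    show "(\<lambda>R. (A \<inter> R, R - A)) ` ?S \<subseteq> ?T"
    proof (intro image_subsetI)
      fix R assume R: "R \<in> ?S"
      then have "finite R" using assms(1) finite_subset by blast
      then have "card (R - A) = r - k"
        using R card_Diff_subset_Int[of R A] by (simp add: Int_commute)
      then show "(A \<inter> R, R - A) \<in> ?T" using R by auto
    qed
    show "(\<lambda>(X, Y). X \<union> Y) ` ?T \<subseteq> ?S"
    proof clarify
      fix X Y assume X: "X \<subseteq> A \<inter> B" and Y: "Y \<subseteq> B - A" "card Y = r - card X"
        and k: "k = card X"
      have "finite X" "finite Y" using X Y assms(1) finite_subset by blast+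
      then have "card (X \<union> Y) = r"
        using X Y assms(2) k by (subst card_Un_disjoint) auto
      moreover have "A \<inter> (X \<union> Y) = X" using X Y by blast
      ultimately show "X \<union> Y \<subseteq> B \<and> card (X \<union> Y) = r \<and> card (A \<inter> (X \<union> Y)) = card X"
        using X Y by auto
    qed
  qed auto
  then have "card ?S = card ?T" by (rule bij_betw_same_card)
  then show ?thesis
    using assms(1) n_subsets[of "A \<inter> B" k] n_subsets[of "B - A" "r - k"]
    by (simp only: card_cartesian_product finite_Int finite_Diff simp_thms)
qed

lemma perm_type_le: "perm_type r g \<le> r"
  unfolding perm_type_def using card_mono[of "{1..r}" "g ` {1..r} \<inter> {1..r}"] by simp

text \<open>An injective \<open>d\<close> allows the intersection with \<open>{1..r}\<close> to be
  counted before shuffling, where it becomes the intersection with \<open>R\<close>.\<close>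

lemma perm_type_right_mult:
  assumes "inj d"
  shows "perm_type r (right_mult g d) = card (g ` {1..r} \<inter> d -` {1..r})"
proof -
  have "(d \<circ> g) ` {1..r} \<inter> {1..r} = d ` (g ` {1..r} \<inter> d -` {1..r})" by auto
  then show ?thesis
    by (simp add: perm_type_def right_mult_def card_image inj_on_subset[OF assms])
qed

text \<open>\<open>pmf_of_set\<close> is meaningful only for finite nonempty sets. The bound
  \<open>2 * r \<le> n\<close> leaves room for the subset \<open>{r + 1..2 * r}\<close>.\<close>

lemma skewed_shuffles_finite_nonempty:
  assumes "2 * r \<le> n"
  shows "finite (skewed_shuffles n r)" "skewed_shuffles n r \<noteq> {}"
proof -
  let ?S = "{R. R \<subseteq> {r + 1..n} \<and> card R = r}"
  have bij: "bij_betw (\<lambda>d. d -` {1..r}) (skewed_shuffles n r) ?S"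
    using assms by (intro bij_betw_skewed_shuffles) simp
  have "finite ?S" by (rule finite_subset[of _ "Pow {r + 1..n}"]) auto
  then show "finite (skewed_shuffles n r)" by (simp only: bij_betw_finite[OF bij])
  have "{r + 1..2 * r} \<in> ?S" using assms by auto
  then have "(\<lambda>d. d -` {1..r}) ` skewed_shuffles n r \<noteq> {}"
    unfolding bij_betw_imp_surj_on[OF bij] by (metis empty_iff)
  then show "skewed_shuffles n r \<noteq> {}" by (simp only: image_is_empty simp_thms)
qed

lemma set_skewed_shuffle_step:
  assumes "2 * r \<le> n" "g \<in> Sym n"
  shows "set_pmf (skewed_shuffle_step n r g) \<subseteq> Sym n"
proof -
  have "d \<circ> g \<in> Sym n" if "d \<in> skewed_shuffles n r" for d
    using that assms(2) by (simp add: skewed_shuffles_def Sym_def permutes_compose)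
  then show ?thesis
    by (simp add: skewed_shuffle_step_def right_mult_def image_subset_iff
        skewed_shuffles_finite_nonempty[OF assms(1)])
qed

text \<open>The next type is \<open>card (?A \<inter> R)\<close> for a uniform \<open>R\<close>,
  which is hypergeometric with parameters determined by
  \<open>card (?A \<inter> ?B)\<close>.\<close>

lemma pmf_type_skewed_shuffle_step:
  assumes n: "2 * r \<le> n" and g: "g \<in> Sym n"
  defines "x \<equiv> perm_type r g"
  shows "pmf (map_pmf (perm_type r) (skewed_shuffle_step n r g)) k =
    (if k \<le> r then real ((r - x) choose k) * real ((n - 2 * r + x) choose (r - k))
       / real ((n - r) choose r) else 0)"
proof -
  let ?B = "{r + 1..n}" and ?A = "g ` {1..r}"
  let ?S = "{R. R \<subseteq> ?B \<and> card R = r}" and ?D = "skewed_shuffles n r"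
  note fin = skewed_shuffles_finite_nonempty[OF n]
  have bij: "bij_betw (\<lambda>d. d -` {1..r}) ?D ?S"
    using n by (intro bij_betw_skewed_shuffles) simp
  have S: "finite ?S" "?S \<noteq> {}"
    using bij_betw_finite[OF bij] fin bij_betw_imp_surj_on[OF bij, symmetric]
    by (simp_all only: image_is_empty simp_thms)
  have cS: "card ?S = (n - r) choose r" by (simp add: n_subsets)
  have "map_pmf (perm_type r) (skewed_shuffle_step n r g)
      = map_pmf (\<lambda>d. card (?A \<inter> d -` {1..r})) (pmf_of_set ?D)"
    unfolding skewed_shuffle_step_def pmf.map_comp
  proof (intro map_pmf_cong refl)
    fix d assume "d \<in> set_pmf (pmf_of_set ?D)"
    then have "d \<in> ?D" using fin by simp
    then have "inj d" using skewed_shufflesD(1)[of d n r] n permutes_inj[of d] by simp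
    then show "(perm_type r \<circ> right_mult g) d = card (?A \<inter> d -` {1..r})"
      by (simp add: perm_type_right_mult)
  qed
  also have "\<dots> = map_pmf (\<lambda>R. card (?A \<inter> R)) (map_pmf (\<lambda>d. d -` {1..r}) (pmf_of_set ?D))"
    by (simp add: pmf.map_comp o_def)
  also have "map_pmf (\<lambda>d. d -` {1..r}) (pmf_of_set ?D) = pmf_of_set ?S"
    using map_pmf_of_set_bij_betw[OF bij fin(2,1)] .
  finally have "pmf (map_pmf (perm_type r) (skewed_shuffle_step n r g)) k
      = real (card (?S \<inter> (\<lambda>R. card (?A \<inter> R)) -` {k})) / real (card ?S)"
    using S by (simp add: pmf_map measure_pmf_of_set)
  also have "?S \<inter> (\<lambda>R. card (?A \<inter> R)) -` {k}
      = {R. R \<subseteq> ?B \<and> card R = r \<and> card (?A \<inter> R) = k}"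
    by auto
  finally have *: "pmf (map_pmf (perm_type r) (skewed_shuffle_step n r g)) k
      = real (card {R. R \<subseteq> ?B \<and> card R = r \<and> card (?A \<inter> R) = k}) / real ((n - r) choose r)"
    by (simp only: cS)
  have gp: "g permutes {1..n}" using g by (simp add: Sym_def)
  have sub: "?A \<subseteq> {1..n}"
    using permutes_image[OF gp] image_mono[of "{1..r}" "{1..n}" g] n by simp
  have cA: "card ?A = r"
    using card_image[OF inj_on_subset[OF permutes_inj[OF gp] subset_UNIV]] by simp
  \<comment> \<open>Of the \<open>r\<close> points of \<open>?A\<close>, exactly \<open>x\<close>
    lie in \<open>{1..r}\<close>; the other \<open>r - x\<close> lie in \<open>?B\<close>, which
    leaves \<open>(n - r) - (r - x)\<close> points of \<open>?B\<close> outside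
    \<open>?A\<close>.\<close>
  have "?A \<inter> ?B = ?A - ?A \<inter> {1..r}" using sub by auto
  then have AB: "card (?A \<inter> ?B) = r - x"
    using cA by (simp add: x_def perm_type_def card_Diff_subset)
  have "card (?B - ?A) = card ?B - card (?A \<inter> ?B)"
    by (simp add: card_Diff_subset_Int Int_commute)
  then have BA: "card (?B - ?A) = n - 2 * r + x"
    using AB n perm_type_le[of r g] by (simp add: x_def)
  show ?thesis
  proof (cases "k \<le> r")
    case True
    then show ?thesis
      by (simp only: * card_subsets_with_intersection[OF finite_atLeastAtMost True] AB BA
          if_True of_nat_mult)
  next
    case False
    have "card (?A \<inter> R) \<le> r" for R
      using card_mono[of ?A "?A \<inter> R"] cA by simp
    then have "{R. R \<subseteq> ?B \<and> card R = r \<and> card (?A \<inter> R) = k} = {}"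
      using False by blast
    then show ?thesis unfolding * using False by (simp only: card.empty) simp
  qed
qed

text \<open>Every state must be attained from some permutation, since an induced chain is pinned
  down only at attained types.\<close>

lemma exists_perm_type:
  assumes "2 * r \<le> n" "x \<le> r"
  obtains g where "g \<in> Sym n" "perm_type r g = x"
proof
  \<comment> \<open>The top block shifts down the deck by \<open>r - x\<close>, keeping
    \<open>x\<close> of its points within \<open>{1..r}\<close>; the \<open>r - x\<close> displaced
    positions \<open>{r + 1..2 * r - x}\<close> fill the gap \<open>{1..r - x}\<close>.\<close>
  define g where "g i = (if i \<in> {1..r} then i + (r - x)
    else if i \<in> {r + 1..2 * r - x} then i - r else i)" for i
  have "bij_betw g {1..n} {1..n}"
    by (rule bij_betw_byWitness[where f' = "\<lambda>i. if i \<in> {1..r - x} then i + r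
          else if i \<in> {r - x + 1..2 * r - x} then i - (r - x) else i"])
       (use assms in \<open>auto simp: g_def\<close>)
  then show "g \<in> Sym n"
    unfolding Sym_def using assms by (auto simp: g_def intro!: bij_imp_permutes)
  have "g ` {1..r} = (\<lambda>i. i + (r - x)) ` {1..r}"
    by (intro image_cong) (auto simp: g_def)
  also have "\<dots> = {1 + (r - x)..r + (r - x)}" by (rule image_add_atLeastAtMost')
  finally have "g ` {1..r} \<inter> {1..r} = {r - x + 1..r}"
    by (auto simp del: image_add_atLeastAtMost')
  then show "perm_type r g = x"
    using assms by (simp add: perm_type_def)
qed

text \<open>In factorials, both products of binomials have the denominator
  \<open>(r-y)! (y-x)! y! (m+x-y)!\<close>, so their ratio involves only \<open>x\<close>.\<close>

lemma binomial_eps_bar: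
  assumes "x \<le> y" "y \<le> r"
  shows "real ((r - x) choose (r - y)) * real ((m + x) choose y)
    = fact (r - x) * fact (m + x) / (fact r * fact m) * eps_bar r r m x y"
proof (cases "y \<le> m + x")
  case True
  then have "y - x \<le> m" "m - (y - x) = m + x - y" "r - x - (r - y) = y - x"
    using assms by auto
  then show ?thesis
    using assms True by (simp add: eps_bar_def binomial_fact)
next
  case False
  \<comment> \<open>Here a binomial coefficient vanishes on each side.\<close>
  then have "m + x < y" "m < y - x" using assms by auto
  then show ?thesis by (simp add: eps_bar_def binomial_eq_0)
qed

text \<open>Vandermonde's identity evaluates the normalising sum; for \<open>m = n - 2 * r\<close>
  the result is the hypergeometric denominator.\<close>

lemma sum_binomial_eps_bar:
  assumes "x \<le> r"
  shows "fact (r - x) * fact (m + x) / (fact r * fact m) * (\<Sum>y = x..r. eps_bar r r m x y)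
    = real ((m + r) choose r)"
proof -
  have "fact (r - x) * fact (m + x) / (fact r * fact m) * (\<Sum>y = x..r. eps_bar r r m x y)
      = (\<Sum>y = x..r. real ((m + x) choose y) * real ((r - x) choose (r - y)))"
    unfolding sum_distrib_left
    by (intro sum.cong refl) (subst binomial_eps_bar[symmetric], auto)
  \<comment> \<open>The added terms \<open>y < x\<close> vanish because
    \<open>r - y > r - x\<close>.\<close>
  also have "\<dots> = (\<Sum>y\<le>r. real ((m + x) choose y) * real ((r - x) choose (r - y)))"
    using assms by (intro sum.mono_neutral_left) auto
  also have "\<dots> = real ((m + x + (r - x)) choose r)"
    by (simp flip: vandermonde)
  finally show ?thesis using assms by simp
qed

lemma pmf_type_skewed_shuffle_step_eps_bar:
  assumes n: "2 * r \<le> n" and g: "g \<in> Sym n" and y: "y \<le> r"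
  defines "x \<equiv> perm_type r g"
  shows "pmf (map_pmf (perm_type r) (skewed_shuffle_step n r g)) (r - y) =
    (if y < x then 0
     else eps_bar r r (n - 2 * r) x y / (\<Sum>u = x..r. eps_bar r r (n - 2 * r) x u))"
proof (cases "y < x")
  case True
  then have "r - x < r - y"
    using perm_type_le[of r g] by (simp add: x_def)
  then show ?thesis
    using True by (simp add: pmf_type_skewed_shuffle_step[OF n g] x_def binomial_eq_0)
next
  case False
  let ?m = "n - 2 * r"
  let ?c = "fact (r - x) * fact (?m + x) / (fact r * fact ?m) :: real"
  have x: "x \<le> r" by (simp add: x_def perm_type_le)
  have "pmf (map_pmf (perm_type r) (skewed_shuffle_step n r g)) (r - y)
      = real ((r - x) choose (r - y)) * real ((?m + x) choose y) / real ((?m + r) choose r)"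
    using n y by (simp add: pmf_type_skewed_shuffle_step[OF n g] x_def)
  also have "\<dots> = ?c * eps_bar r r ?m x y / (?c * (\<Sum>u = x..r. eps_bar r r ?m x u))"
    using False x y by (simp only: binomial_eps_bar sum_binomial_eps_bar not_less)
  also have "\<dots> = eps_bar r r ?m x y / (\<Sum>u = x..r. eps_bar r r ?m x u)"
    by (rule mult_divide_mult_cancel_left) simp
  finally show ?thesis using False by simp
qed

lemma map_type_skewed_shuffle_step_cong:
  assumes "2 * r \<le> n" "g \<in> Sym n" "h \<in> Sym n" "perm_type r g = perm_type r h"
  shows "map_pmf (perm_type r) (skewed_shuffle_step n r g)
    = map_pmf (perm_type r) (skewed_shuffle_step n r h)"
  by (rule pmf_eqI) (simp add: assms pmf_type_skewed_shuffle_step)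

section \<open>The induced chain\<close>

lemma exists_induced_type_chain:
  assumes n: "2 * r \<le> n"
  shows "\<exists>M. induced_type_chain n r M"
proof
  \<comment> \<open>Any representative of the type will do by the preceding lemma. For
    \<open>x > r\<close> no permutation has type \<open>x\<close> and the choice is arbitrary, which
    is harmless as such states are never visited.\<close>
  define M where "M x = map_pmf (perm_type r)
    (skewed_shuffle_step n r (SOME g. g \<in> Sym n \<and> perm_type r g = x))" for x
  have M: "map_pmf (perm_type r) (skewed_shuffle_step n r g) = M (perm_type r g)"
    if g: "g \<in> Sym n" for g
    unfolding M_def
    using someI[of "\<lambda>h. h \<in> Sym n \<and> perm_type r h = perm_type r g" g] g
    by (intro map_type_skewed_shuffle_step_cong n) auto
  show "induced_type_chain n r M"
    unfolding induced_type_chain_def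
  proof (intro allI impI)
    fix \<mu> :: "(nat \<Rightarrow> nat) pmf" assume "set_pmf \<mu> \<subseteq> Sym n"
    then have "(\<lambda>t. map_pmf (map (perm_type r)) (trajectory (skewed_shuffle_step n r) \<mu> t))
        = trajectory M (map_pmf (perm_type r) \<mu>)"
      using set_skewed_shuffle_step[OF n] M
      by (intro ext map_trajectory_lumpable[where S = "Sym n"])
    then show "markov_chain
        (\<lambda>t. map_pmf (map (perm_type r)) (trajectory (skewed_shuffle_step n r) \<mu> t)) M"
      by (simp only: trajectory_markov_chain)
  qed
qed

text \<open>Starting deterministically at \<open>g\<close>, the history
  \<open>[perm_type r g]\<close> has probability one, so the Markov property at time 0 reads off the
  transition law with vacuous conditioning.\<close>

lemma induced_type_chain_eq:
  assumes M: "induced_type_chain n r M" and g: "g \<in> Sym n"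
  shows "M (perm_type r g) = map_pmf (perm_type r) (skewed_shuffle_step n r g)"
proof (rule pmf_eqI)
  fix z
  let ?f = "perm_type r" and ?K = "skewed_shuffle_step n r"
  let ?L = "map_pmf (map ?f) (trajectory ?K (return_pmf g) (Suc 0))"
  have L: "?L = map_pmf (\<lambda>z. [?f g, z]) (map_pmf ?f (?K g))"
    by (simp add: bind_return_pmf pmf.map_comp o_def)
  have but: "\<P>(ys in measure_pmf ?L. butlast ys = [?f g]) = 1"
    unfolding L by simp
  have last: "\<P>(ys in measure_pmf ?L. last ys = z) = pmf (map_pmf ?f (?K g)) z"
    unfolding L pmf_map[of ?f] by (simp add: vimage_def)
  have last_but: "\<P>(ys in measure_pmf ?L. last ys = z \<and> butlast ys = [?f g])
      = \<P>(ys in measure_pmf ?L. last ys = z)"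
    unfolding L by simp
  have "\<P>(ys in measure_pmf ?L. last ys = z \<bar> butlast ys = [?f g])
      = pmf (map_pmf ?f (?K g)) z"
    unfolding cond_prob_def but by (simp only: last_but last div_by_1)
  moreover have mc: "markov_chain (\<lambda>t. map_pmf (map ?f) (trajectory ?K (return_pmf g) t)) M"
    by (rule M[unfolded induced_type_chain_def, rule_format]) (simp add: g)
  have "\<P>(ys in measure_pmf ?L. last ys = z \<bar> butlast ys = [?f g])
      = pmf (M (last [?f g])) z"
    by (rule mc[unfolded markov_chain_def, rule_format]) (simp only: but zero_less_one)
  ultimately show "pmf (M (?f g)) z = pmf (map_pmf ?f (?K g)) z" by simp
qed

text \<open>The intermediate law \<open>q\<close> is recovered by reflecting \<open>P x\<close>, as
  \<open>z \<mapsto> r - z\<close> is an involution on \<open>{0..r}\<close>.\<close>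

lemma weighted_involutory_walkI:
  assumes supp: "\<And>x. x \<le> r \<Longrightarrow> set_pmf (P x) \<subseteq> {0..r}"
    and pmf: "\<And>x y. x \<le> r \<Longrightarrow> y \<le> r \<Longrightarrow>
      pmf (P x) (r - y) = (if y < x then 0 else \<gamma> x y / (\<Sum>u = x..r. \<gamma> x u))"
  shows "weighted_involutory_walk r \<gamma> P"
  unfolding weighted_involutory_walk_def
proof (intro ballI exI conjI allI)
  fix x assume "x \<in> {0..r}"
  then have x: "x \<le> r" by simp
  let ?q = "map_pmf (\<lambda>z. r - z) (P x)"
  show "P x = map_pmf (\<lambda>y. r - y) ?q"
  proof -
    have "map_pmf (\<lambda>y. r - y) ?q = map_pmf (\<lambda>z. z) (P x)"
      unfolding pmf.map_comp using supp[OF x] by (intro map_pmf_cong) auto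
    then show ?thesis by simp
  qed
  show "pmf ?q y = (if y \<in> {x..r} then \<gamma> x y / (\<Sum>u = x..r. \<gamma> x u) else 0)" for y
  proof (cases "y \<le> r")
    case True
    \<comment> \<open>For \<open>y = 0\<close> truncated subtraction makes the preimage all of
      \<open>{r..}\<close>, so the support bound is what reduces it to one point.\<close>
    have "pmf ?q y = measure (measure_pmf (P x)) {r - y}"
      unfolding pmf_map using supp[OF x] True
      by (intro measure_pmf.finite_measure_eq_AE) (auto simp: AE_measure_pmf_iff)
    then show ?thesis using True pmf[OF x True] by (simp add: measure_pmf_single)
  next
    case False
    then have "y \<notin> set_pmf ?q" by auto
    then show ?thesis using False by (simp add: set_pmf_iff del: set_map_pmf)
  qed
qed

theorem theorem3p3:
  fixes n r :: nat
  assumes "n > 2 * r"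
  shows "(\<exists>M. induced_type_chain n r M) \<and>
    (\<forall>M. induced_type_chain n r M \<longrightarrow>
      weighted_involutory_walk r (eps_bar r r (n - 2 * r)) M \<and>
      (\<forall>x\<in>{0..r}. \<forall>y\<in>{0..r}.
        pmf (M x) (r - y) =
          (if y < x then 0
           else eps_bar r r (n - 2 * r) x y / (\<Sum>u = x..r. eps_bar r r (n - 2 * r) x u))))"
proof (intro conjI allI impI)
  have n: "2 * r \<le> n" using assms by simp
  show "\<exists>M. induced_type_chain n r M" by (rule exists_induced_type_chain[OF n])
  fix M assume M: "induced_type_chain n r M"
  \<comment> \<open>An arbitrary induced chain is identified, state by state, with a one-step law of
    the shuffle, to which the computed probabilities apply.\<close>
  have rep: "\<exists>g \<in> Sym n. perm_type r g = x
      \<and> M x = map_pmf (perm_type r) (skewed_shuffle_step n r g)" if "x \<le> r" for x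
    using exists_perm_type[OF n that] induced_type_chain_eq[OF M] by metis
  have pmf: "pmf (M x) (r - y) =
      (if y < x then 0
       else eps_bar r r (n - 2 * r) x y / (\<Sum>u = x..r. eps_bar r r (n - 2 * r) x u))"
    if "x \<le> r" "y \<le> r" for x y
    using rep[OF that(1)] pmf_type_skewed_shuffle_step_eps_bar[OF n _ that(2)] by metis
  have supp: "set_pmf (M x) \<subseteq> {0..r}" if x: "x \<le> r" for x
    using rep[OF x] perm_type_le by auto
  show "weighted_involutory_walk r (eps_bar r r (n - 2 * r)) M"
    using supp pmf by (rule weighted_involutory_walkI)
  show "\<forall>x\<in>{0..r}. \<forall>y\<in>{0..r}. pmf (M x) (r - y) =
          (if y < x then 0
           else eps_bar r r (n - 2 * r) x y / (\<Sum>u = x..r. eps_bar r r (n - 2 * r) x u))"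
    using pmf by auto
qed

end
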